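(* Let $\alpha=(\alpha_1,\dots,\alpha_m)$ be a generic length vector with $\alpha_m<\sum_{i<m}\alpha_i$. Define the $(m-2)$-dimensional polytope $\mathrm{Q}(\alpha)\subset\mathbb{R}^{m-2}$ by $\mathrm{Q}(\alpha)=\prod_{i=1}^{m-2}[-\alpha_i,\alpha_i]\cap\{x:\sum_{i=1}^{m-2}x_i\ge\alpha_m-\alpha_{m-1}\}$ if $\{m-1,m\}$ is $\alpha$-long, and $\mathrm{Q}(\alpha)=\prod_{i=1}^{m-2}[-\alpha_i,\alpha_i]\cap\{x:\sum_{i=1}^{m-2}x_i\ge\alpha_m-\alpha_{m-1}\}\cap\{x:\sum_{i=1}^{m-2}x_i\le\alpha_m+\alpha_{m-1}\}$ if $\{m-1,m\}$ is $\alpha$-short. Then the moment polytope $\mathrm{P}(\alpha)$ is affinely isomorphic to $\mathrm{Q}(\alpha)$.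
   Context: A length vector is a tuple of positive reals; generic means $\sum_i\varepsilon_i\alpha_i\ne0$ for all signs. $I\subseteq[m]$ is $\alpha$-short if $\sum_{i\in I}\alpha_i<\sum_{j\notin I}\alpha_j$ and $\alpha$-long otherwise. Moment polytope: $\mathrm{P}(\alpha)=\prod_{i=1}^{m-1}[-\alpha_i,\alpha_i]\cap\{w\in\mathbb{R}^{m-1}:\sum_{i=1}^{m-1}w_i=\alpha_m\}$. *)

theory Defs
  imports "HOL-Analysis.Analysis" "HOL-Analysis.Finite_Function_Topology"
begin

text \<open>
  The polytopes live in coordinate spaces of dimensions \<open>m - 1\<close> and \<open>m - 2\<close>, and the latter
  is \<open>0\<close> for \<open>m = 2\<close>. Coordinate spaces are therefore realised as subspaces of the real vector
  space \<^typ>\<open>nat \<Rightarrow>\<^sub>0 real\<close>: the space of dimension \<open>n\<close> consists of the vectors whose coordinates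
  outside \<open>{1..n}\<close> vanish. A tuple \<open>(\<alpha>\<^sub>1, \<dots>, \<alpha>\<^sub>m)\<close> is a function \<^typ>\<open>nat \<Rightarrow> real\<close> of which only
  the values on \<open>{1..m}\<close> are used.
\<close>

definition coord_space :: "nat \<Rightarrow> (nat \<Rightarrow>\<^sub>0 real) set" where
  "coord_space n = {x. Poly_Mapping.keys x \<subseteq> {1..n}}"

definition coord_sum :: "nat \<Rightarrow> (nat \<Rightarrow>\<^sub>0 real) \<Rightarrow> real" where
  "coord_sum n x = (\<Sum>i = 1..n. Poly_Mapping.lookup x i)"

definition length_vector :: "nat \<Rightarrow> (nat \<Rightarrow> real) \<Rightarrow> bool" where
  "length_vector m \<alpha> \<longleftrightarrow> (\<forall>i\<in>{1..m}. 0 < \<alpha> i)"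

definition generic :: "nat \<Rightarrow> (nat \<Rightarrow> real) \<Rightarrow> bool" where
  "generic m \<alpha> \<longleftrightarrow>
     (\<forall>\<epsilon> :: nat \<Rightarrow> real. (\<forall>i\<in>{1..m}. \<epsilon> i \<in> {-1, 1}) \<longrightarrow> (\<Sum>i = 1..m. \<epsilon> i * \<alpha> i) \<noteq> 0)"

definition short :: "nat \<Rightarrow> (nat \<Rightarrow> real) \<Rightarrow> nat set \<Rightarrow> bool" where
  "short m \<alpha> I \<longleftrightarrow> I \<subseteq> {1..m} \<and> (\<Sum>i\<in>I. \<alpha> i) < (\<Sum>j\<in>{1..m} - I. \<alpha> j)"

definition long :: "nat \<Rightarrow> (nat \<Rightarrow> real) \<Rightarrow> nat set \<Rightarrow> bool" where
  "long m \<alpha> I \<longleftrightarrow> I \<subseteq> {1..m} \<and> \<not> short m \<alpha> I"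

definition coord_box :: "nat \<Rightarrow> (nat \<Rightarrow> real) \<Rightarrow> (nat \<Rightarrow>\<^sub>0 real) set" where
  "coord_box n \<alpha> =
     {x \<in> coord_space n. \<forall>i\<in>{1..n}. Poly_Mapping.lookup x i \<in> {- \<alpha> i..\<alpha> i}}"

definition moment_polytope :: "nat \<Rightarrow> (nat \<Rightarrow> real) \<Rightarrow> (nat \<Rightarrow>\<^sub>0 real) set" where
  "moment_polytope m \<alpha> = coord_box (m - 1) \<alpha> \<inter> {w. coord_sum (m - 1) w = \<alpha> m}"

definition Q_polytope :: "nat \<Rightarrow> (nat \<Rightarrow> real) \<Rightarrow> (nat \<Rightarrow>\<^sub>0 real) set" where
  "Q_polytope m \<alpha> =
     (if long m \<alpha> {m - 1, m}
      then coord_box (m - 2) \<alpha> \<inter> {x. coord_sum (m - 2) x \<ge> \<alpha> m - \<alpha> (m - 1)}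
      else coord_box (m - 2) \<alpha> \<inter> {x. coord_sum (m - 2) x \<ge> \<alpha> m - \<alpha> (m - 1)}
             \<inter> {x. coord_sum (m - 2) x \<le> \<alpha> m + \<alpha> (m - 1)})"

text \<open>
  The library's \<^const>\<open>aff_dim\<close> is confined to Euclidean spaces; the following is its defining
  property, stated for arbitrary real vector spaces.
\<close>

definition polytope_of_dim :: "nat \<Rightarrow> 'a::real_vector set \<Rightarrow> bool" where
  "polytope_of_dim d S \<longleftrightarrow> polytope S \<and>
     (\<exists>B. affine hull B = affine hull S \<and> \<not> affine_dependent B \<and> card B = d + 1)"

lemma polytope_of_dim_iff_aff_dim:
  fixes S :: "'a::euclidean_space set"
  shows "polytope_of_dim d S \<longleftrightarrow> polytope S \<and> aff_dim S = int d"
proof -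
  have "(\<exists>B. affine hull B = affine hull S \<and> \<not> affine_dependent B \<and> card B = d + 1)
        \<longleftrightarrow> aff_dim S = int d"
  proof
    assume "\<exists>B. affine hull B = affine hull S \<and> \<not> affine_dependent B \<and> card B = d + 1"
    then obtain B where "affine hull B = affine hull S" "\<not> affine_dependent B" "card B = d + 1"
      by blast
    with aff_dim_unique[of B S] show "aff_dim S = int d"
      by simp
  next
    assume *: "aff_dim S = int d"
    obtain B where "affine hull B = affine hull S" "\<not> affine_dependent B"
        "int (card B) = aff_dim S + 1"
      using aff_dim_basis_exists by blast
    with * show "\<exists>B. affine hull B = affine hull S \<and> \<not> affine_dependent B \<and> card B = d + 1"
      by (intro exI[of _ B]) auto
  qed
  then show ?thesis
    by (simp add: polytope_of_dim_def)
qed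

definition affine_map_on :: "'a::real_vector set \<Rightarrow> 'b::real_vector set \<Rightarrow> ('a \<Rightarrow> 'b) \<Rightarrow> bool" where
  "affine_map_on U V f \<longleftrightarrow> f ` U \<subseteq> V \<and>
     (\<forall>x\<in>U. \<forall>y\<in>U. \<forall>t. f ((1 - t) *\<^sub>R x + t *\<^sub>R y) = (1 - t) *\<^sub>R f x + t *\<^sub>R f y)"

text \<open>
  A polytope in dimension \<open>d\<close> and one in dimension \<open>e\<close> are affinely isomorphic if some affine map
  between the ambient spaces, not necessarily injective or surjective there, restricts to a
  bijection between the two polytopes.
\<close>

definition affinely_isomorphic ::
    "nat \<Rightarrow> (nat \<Rightarrow>\<^sub>0 real) set \<Rightarrow> nat \<Rightarrow> (nat \<Rightarrow>\<^sub>0 real) set \<Rightarrow> bool" where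
  "affinely_isomorphic d S e T \<longleftrightarrow>
     (\<exists>f. affine_map_on (coord_space d) (coord_space e) f \<and> bij_betw f S T)"

end

theory Submission
  imports Defs
begin

text \<open>
  On \<open>P(\<alpha>)\<close> the last coordinate is determined by the others through the equation
  \<open>w\<^sub>1 + \<dots> + w\<^bsub>m-1\<^esub> = \<alpha>\<^sub>m\<close>, so forgetting it is injective; the bound on it becomes the
  two inequalities \<open>\<alpha>\<^sub>m - \<alpha>\<^bsub>m-1\<^esub> \<le> x\<^sub>1 + \<dots> + x\<^bsub>m-2\<^esub> \<le> \<alpha>\<^sub>m + \<alpha>\<^bsub>m-1\<^esub>\<close>. When \<open>{m - 1, m}\<close> is long,
  the upper one already holds on the box.

  The image has full dimension because some multiple \<open>t (\<alpha>\<^sub>1, \<dots>, \<alpha>\<^bsub>m-2\<^esub>)\<close> with \<open>-1 < t < 1\<close>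
  satisfies all inequalities strictly. It is a polytope because cutting the convex hull of a
  finite set \<open>V\<close> by a half-space leaves the convex hull of the points of \<open>V\<close> inside it and of the
  points where segments between points of \<open>V\<close> cross the bounding hyperplane.
\<close>

section \<open>Cutting a polytope by a half-space\<close>

lemma polytope_Int_halfspace_le:
  fixes S :: "'a::real_vector set" and l :: "'a \<Rightarrow> real"
  assumes "polytope S" and l: "linear l"
  shows "polytope (S \<inter> {x. l x \<le> c})"
proof -
  obtain V where V: "finite V" and S: "S = convex hull V"
    using assms(1) by (auto simp: polytope_def)
  define A where "A = {v \<in> V. l v \<le> c}"
  define B where "B = {v \<in> V. c < l v}"
  have fin: "finite A" "finite B"
    using V by (auto simp: A_def B_def)
  \<comment> \<open>As \<open>l a \<le> c < l b\<close>, the segment from \<open>a\<close> to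
    \<open>b\<close> meets the hyperplane \<open>l = c\<close> in exactly one point. The weights
    come from solving the linear equation for that point.\<close>
  define y where "y = (\<lambda>(a, b). ((l b - c) / (l b - l a)) *\<^sub>R a + ((c - l a) / (l b - l a)) *\<^sub>R b)"
  define W where "W = A \<union> y ` (A \<times> B)"
  have "finite W"
    using fin by (simp add: W_def)
  have "W \<subseteq> S \<inter> {x. l x \<le> c}"
  proof
    fix w assume "w \<in> W"
    then consider "w \<in> A" | a b where "a \<in> A" "b \<in> B" "w = y (a, b)"
      by (auto simp: W_def)
    then show "w \<in> S \<inter> {x. l x \<le> c}"
    proof cases
      case 1
      then show ?thesis
        by (auto simp: A_def S hull_inc)
    next
      case 2
      then have ab: "l a \<le> c" "c < l b" "a \<in> S" "b \<in> S"
        by (auto simp: A_def B_def S hull_inc)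
      have "convex S"
        by (simp add: S)
      then have "w \<in> S"
        using ab unfolding \<open>w = y (a, b)\<close> y_def prod.case
        by (intro convexD) (simp_all flip: add_divide_distrib)
      moreover have "l w = c"
      proof -
        have "l w = ((l b - c) * l a + (c - l a) * l b) / (l b - l a)"
          by (simp add: \<open>w = y (a, b)\<close> y_def linear_add[OF l] linear_scale[OF l] add_divide_distrib)
        also have "(l b - c) * l a + (c - l a) * l b = c * (l b - l a)"
          by (simp add: algebra_simps)
        finally show ?thesis
          using ab by simp
      qed
      ultimately show ?thesis
        by simp
    qed
  qed
  moreover have "convex (S \<inter> {x. l x \<le> c})"
    using convex_linear_vimage[OF l, of "{..c}"] by (simp add: S convex_Int vimage_def)
  ultimately have 1: "convex hull W \<subseteq> S \<inter> {x. l x \<le> c}"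
    by (rule hull_minimal)
  have "x \<in> convex hull W" if "x \<in> S" "l x \<le> c" for x
  proof -
    obtain u where u: "\<And>v. v \<in> V \<Longrightarrow> 0 \<le> u v" "sum u V = 1" and x: "x = (\<Sum>v\<in>V. u v *\<^sub>R v)"
      using \<open>x \<in> S\<close> by (auto simp: S convex_hull_finite[OF V])
    have V_AB: "V = A \<union> B" "A \<inter> B = {}"
      by (auto simp: A_def B_def)
    have sum_V: "sum g V = sum g A + sum g B" for g :: "'a \<Rightarrow> 'b::comm_monoid_add"
      unfolding V_AB(1) by (rule sum.union_disjoint[OF fin V_AB(2)])
    have uA: "0 \<le> u a" if "a \<in> A" for a using that u by (simp add: A_def)
    have uB: "0 \<le> u b" if "b \<in> B" for b using that u by (simp add: B_def)
    \<comment> \<open>\<open>D\<close> is the weighted depth of \<open>A\<close> below the level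
      \<open>c\<close>, and \<open>E\<close> the weighted height of \<open>B\<close> above it. Since
      \<open>E - D = l x - c\<close>, the bound \<open>l x \<le> c\<close> says that the depth can
      balance the height.\<close>
    define D where "D = (\<Sum>a\<in>A. u a * (c - l a))"
    define E where "E = (\<Sum>b\<in>B. u b * (l b - c))"
    have "l x = (\<Sum>v\<in>V. u v * l v)"
      by (simp add: x linear_sum[OF l] linear_scale[OF l])
    then have "E - D = l x - c"
      using sum_V[of "\<lambda>v. u v * l v"] sum_V[of u] u(2)
      by (simp add: D_def E_def right_diff_distrib sum_subtractf flip: sum_distrib_right)
         (simp add: algebra_simps flip: distrib_left)
    then have "E \<le> D"
      using \<open>l x \<le> c\<close> by simp
    have "0 \<le> E"
      unfolding E_def using uB by (intro sum_nonneg mult_nonneg_nonneg) (auto simp: B_def)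
    show ?thesis
    \<comment> \<open>Every point of \<open>B\<close> lies strictly above the level, so
      \<open>E = 0\<close> forces all weights on \<open>B\<close> to vanish and \<open>x\<close> is
      a combination of \<open>A\<close> alone. Otherwise \<open>D \<ge> E > 0\<close>, and division
      by \<open>D\<close> is possible.\<close>
    proof (cases "E = 0")
      case True
      then have "\<forall>b\<in>B. u b * (l b - c) = 0"
        unfolding E_def using uB fin by (subst (asm) sum_nonneg_eq_0_iff) (auto simp: B_def)
      then have "\<forall>b\<in>B. u b = 0"
        by (auto simp: B_def)
      then have "sum u A = 1" "x = (\<Sum>a\<in>A. u a *\<^sub>R a)"
        using u(2) by (simp_all add: x sum_V)
      then have "x \<in> convex hull A"
        using uA by (auto simp: convex_hull_finite[OF fin(1)])
      then show ?thesis
        using hull_mono[of A W convex] by (auto simp: W_def)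
    next
      case False
      with \<open>0 \<le> E\<close> \<open>E \<le> D\<close> have D: "0 < D"
        by simp
      \<comment> \<open>The mass of each \<open>b \<in> B\<close> is paired with mass of the points \<open>a \<in> A\<close> in proportion to
        \<open>u a * (c - l a)\<close>; this uses up the fraction \<open>E / D\<close> of the mass of each \<open>a\<close>.\<close>
      define q where "q = case_sum (\<lambda>a. u a * (1 - E / D)) (\<lambda>(a, b). u a * u b * (l b - l a) / D)"
      define z where "z = case_sum (\<lambda>a. a) y"
      have AB: "l b - l a \<noteq> 0" if "a \<in> A" "b \<in> B" for a b
        using that by (auto simp: A_def B_def)
      \<comment> \<open>Writing \<open>l b - l a\<close> as \<open>(l b - c) + (c - l a)\<close>
        makes the double sum factor: the first part returns the fraction \<open>E / D\<close> taken
        from \<open>A\<close>, the second yields \<open>sum u B\<close>, as the depths add up to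
        \<open>D\<close>.\<close>
      have "(\<Sum>i\<in>A <+> A \<times> B. q i)
          = sum u A * (1 - E / D) + (\<Sum>a\<in>A. \<Sum>b\<in>B. u a * (u b * (l b - c)) / D + u a * (c - l a) * u b / D)"
        by (simp add: sum.Plus fin q_def sum.cartesian_product case_prod_beta
            flip: sum_distrib_right add_divide_distrib) (simp add: algebra_simps)
      also have "(\<Sum>a\<in>A. \<Sum>b\<in>B. u a * (u b * (l b - c)) / D + u a * (c - l a) * u b / D)
          = sum u A * E / D + D * sum u B / D"
        by (simp add: sum.distrib D_def E_def sum_product sum_divide_distrib)
      finally have q1: "(\<Sum>i\<in>A <+> A \<times> B. q i) = 1"
        using D u(2) by (simp add: sum_V right_diff_distrib)
      \<comment> \<open>The factor \<open>l b - l a\<close> in \<open>q\<close> cancels the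
        denominator in \<open>y (a, b)\<close>. Summation then gives each \<open>a\<close> the
        missing coefficient \<open>u a * E / D\<close> and each \<open>b\<close> the coefficient
        \<open>u b\<close>.\<close>
      have "(\<Sum>i\<in>A <+> A \<times> B. q i *\<^sub>R z i)
          = (\<Sum>a\<in>A. (u a * (1 - E / D)) *\<^sub>R a)
          + (\<Sum>a\<in>A. \<Sum>b\<in>B. (u a * (u b * (l b - c)) / D) *\<^sub>R a + (u a * (c - l a) * u b / D) *\<^sub>R b)"
        using AB by (simp add: sum.Plus fin q_def z_def y_def sum.cartesian_product
            scaleR_add_right case_prod_beta mult_ac) (intro sum.cong, auto)
      also have "(\<Sum>a\<in>A. \<Sum>b\<in>B. (u a * (u b * (l b - c)) / D) *\<^sub>R a + (u a * (c - l a) * u b / D) *\<^sub>R b)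
          = (\<Sum>a\<in>A. (u a * E / D) *\<^sub>R a) + (\<Sum>b\<in>B. (D * u b / D) *\<^sub>R b)"
      proof -
        have "(\<Sum>a\<in>A. \<Sum>b\<in>B. (u a * (u b * (l b - c)) / D) *\<^sub>R a) = (\<Sum>a\<in>A. (u a * E / D) *\<^sub>R a)"
          by (simp only: E_def sum_distrib_left sum_divide_distrib scaleR_sum_left)
        moreover have "(\<Sum>b\<in>B. \<Sum>a\<in>A. (u a * (c - l a) * u b / D) *\<^sub>R b)
            = (\<Sum>b\<in>B. (D * u b / D) *\<^sub>R b)"
          by (subst (2) D_def) (simp only: sum_distrib_right sum_divide_distrib scaleR_sum_left)
        ultimately show ?thesis
          by (simp only: sum.distrib sum.swap[of _ B A])
      qed
      also have "(\<Sum>a\<in>A. (u a * (1 - E / D)) *\<^sub>R a)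
          + ((\<Sum>a\<in>A. (u a * E / D) *\<^sub>R a) + (\<Sum>b\<in>B. (D * u b / D) *\<^sub>R b)) = x"
      proof -
        have "u a * (1 - E / D) + u a * E / D = u a" for a
          by (simp add: right_diff_distrib)
        then have "(\<Sum>a\<in>A. (u a * (1 - E / D)) *\<^sub>R a) + (\<Sum>a\<in>A. (u a * E / D) *\<^sub>R a) = (\<Sum>a\<in>A. u a *\<^sub>R a)"
          by (simp only: flip: sum.distrib scaleR_add_left)
        then show ?thesis
          using D by (simp add: x sum_V flip: add.assoc)
      qed
      finally have qx: "(\<Sum>i\<in>A <+> A \<times> B. q i *\<^sub>R z i) = x" .
      have "(\<Sum>i\<in>A <+> A \<times> B. q i *\<^sub>R z i) \<in> convex hull W"
      proof (rule convex_sum[OF _ _ q1])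
        fix i assume i: "i \<in> A <+> A \<times> B"
        \<comment> \<open>The weight left on a point of \<open>A\<close> is nonnegative because
          \<open>E \<le> D\<close>.\<close>
        show "0 \<le> q i"
          using i D \<open>E \<le> D\<close> uA uB
          by (auto simp: q_def A_def B_def intro!: mult_nonneg_nonneg divide_nonneg_nonneg)
        show "z i \<in> convex hull W"
          using i by (intro hull_inc) (auto simp: z_def W_def)
      qed (use fin in auto)
      then show ?thesis
        by (simp add: qx)
    qed
  qed
  with 1 have "S \<inter> {x. l x \<le> c} = convex hull W"
    by blast
  then show ?thesis
    using \<open>finite W\<close> by (auto simp: polytope_def)
qed

lemma polytope_Int_halfspace_ge:
  fixes S :: "'a::real_vector set" and l :: "'a \<Rightarrow> real"
  assumes "polytope S" and "linear l"
  shows "polytope (S \<inter> {x. l x \<ge> c})"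
  using polytope_Int_halfspace_le[OF assms(1) linear_compose_neg[OF assms(2)], of "- c"] by simp

section \<open>Coordinate spaces and boxes\<close>

lemma lookup_scaleR [simp]:
  fixes x :: "'a \<Rightarrow>\<^sub>0 'b::real_vector"
  shows "Poly_Mapping.lookup (c *\<^sub>R x) i = c *\<^sub>R Poly_Mapping.lookup x i"
proof -
  have "{i. c *\<^sub>R Poly_Mapping.lookup x i \<noteq> 0} \<subseteq> Poly_Mapping.keys x"
    by (auto simp: in_keys_iff)
  then have "finite {i. c *\<^sub>R Poly_Mapping.lookup x i \<noteq> 0}"
    by (rule finite_subset) simp
  then show ?thesis
    by (simp add: scaleR_poly_mapping_def)
qed

lemma mem_coord_space_iff: "x \<in> coord_space n \<longleftrightarrow> (\<forall>i. i \<notin> {1..n} \<longrightarrow> Poly_Mapping.lookup x i = 0)"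
  by (auto simp: coord_space_def in_keys_iff)

lemma subspace_coord_space: "subspace (coord_space n)"
  by (auto simp: subspace_def mem_coord_space_iff lookup_add)

lemma linear_coord_sum: "linear (coord_sum n)"
  by (rule linearI) (auto simp: coord_sum_def lookup_add sum.distrib sum_distrib_left)

lemma coord_sum_single: "coord_sum n (Poly_Mapping.single i c) = (if i \<in> {1..n} then c else 0)"
  by (simp add: coord_sum_def lookup_single when_def)

lemma single_mult_eq_scaleR: "Poly_Mapping.single i (c * d) = c *\<^sub>R Poly_Mapping.single i (d::real)"
  by (rule poly_mapping_eqI) (simp add: lookup_single when_def)

text \<open>By induction on the dimension: the next box is the image of the previous one times an
  interval under the linear map that puts the interval's value into the new coordinate.\<close>

lemma polytope_coord_box: "polytope (coord_box n \<alpha>)"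
proof (induction n)
  case 0
  have "coord_box 0 \<alpha> = {0}"
    by (auto simp: coord_box_def coord_space_def)
  then show ?case
    by (simp add: polytope_sing)
next
  case (Suc n)
  define f where "f = (\<lambda>(p, c). p + Poly_Mapping.single (Suc n) (c::real))"
  have "linear f"
    by (intro linearI) (auto simp: f_def algebra_simps single_add single_mult_eq_scaleR)
  moreover have "polytope (coord_box n \<alpha> \<times> {- \<alpha> (Suc n)..\<alpha> (Suc n)})"
    using polytope_interval[of "- \<alpha> (Suc n)" "\<alpha> (Suc n)"] Suc by (intro polytope_Times) auto
  ultimately have "polytope (f ` (coord_box n \<alpha> \<times> {- \<alpha> (Suc n)..\<alpha> (Suc n)}))"
    by (rule polytope_linear_image)
  moreover have "f ` (coord_box n \<alpha> \<times> {- \<alpha> (Suc n)..\<alpha> (Suc n)}) = coord_box (Suc n) \<alpha>"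
  proof (intro equalityI subsetI)
    fix x assume "x \<in> f ` (coord_box n \<alpha> \<times> {- \<alpha> (Suc n)..\<alpha> (Suc n)})"
    then show "x \<in> coord_box (Suc n) \<alpha>"
      by (auto simp: f_def coord_box_def mem_coord_space_iff lookup_add lookup_single when_def
          le_Suc_eq)
  next
    fix x assume x: "x \<in> coord_box (Suc n) \<alpha>"
    define c where "c = Poly_Mapping.lookup x (Suc n)"
    have "x - Poly_Mapping.single (Suc n) c \<in> coord_box n \<alpha>" "c \<in> {- \<alpha> (Suc n)..\<alpha> (Suc n)}"
      using x by (auto simp: c_def coord_box_def mem_coord_space_iff lookup_minus lookup_single when_def)
    moreover have "x = f (x - Poly_Mapping.single (Suc n) c, c)"
      by (simp add: f_def)
    ultimately show "x \<in> f ` (coord_box n \<alpha> \<times> {- \<alpha> (Suc n)..\<alpha> (Suc n)})"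
      by blast
  qed
  ultimately show ?case
    by simp
qed

section \<open>Full dimension in a coordinate space\<close>

text \<open>The point \<open>p\<close> and its \<open>n\<close> displacements along the axes are
  \<open>n + 1\<close> affinely independent points, whose affine hull is already the whole
  coordinate space. For \<open>n = 0\<close> the only point is \<open>p\<close>.\<close>

lemma polytope_of_dim_coord_space:
  assumes "polytope S" and "S \<subseteq> coord_space n" and "p \<in> S"
    and "\<And>i. i \<in> {1..n} \<Longrightarrow> r i \<noteq> 0"
    and "\<And>i. i \<in> {1..n} \<Longrightarrow> p + Poly_Mapping.single i (r i) \<in> S"
  shows "polytope_of_dim n S"
proof -
  define e where "e = (\<lambda>i. Poly_Mapping.single i (r i))"
  define B where "B = insert p ((\<lambda>i. p + e i) ` {1..n})"
  have inj: "inj_on e {1..n}"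
    using assms(4) by (auto simp: inj_on_def e_def poly_mapping_eq_iff fun_eq_iff lookup_single
        when_def split: if_splits)
  have lookup_sum_e: "Poly_Mapping.lookup (\<Sum>i = 1..n. g i *\<^sub>R e i) j = (if j \<in> {1..n} then g j * r j else 0)"
    for g j
    by (simp add: lookup_sum e_def lookup_single when_def if_distrib cong: if_cong)
  have span_e: "span (e ` {1..n}) = coord_space n"
  proof
    show "span (e ` {1..n}) \<subseteq> coord_space n"
      by (rule span_minimal[OF _ subspace_coord_space])
         (auto simp: e_def mem_coord_space_iff lookup_single when_def)
    show "coord_space n \<subseteq> span (e ` {1..n})"
    proof
      fix x assume "x \<in> coord_space n"
      then have "x = (\<Sum>i = 1..n. (Poly_Mapping.lookup x i / r i) *\<^sub>R e i)"
        using assms(4) by (intro poly_mapping_eqI) (auto simp: lookup_sum_e mem_coord_space_iff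
            simp del: One_nat_def)
      also have "\<dots> \<in> span (e ` {1..n})"
        by (intro span_sum span_scale span_base imageI)
      finally show "x \<in> span (e ` {1..n})" .
    qed
  qed
  have indep: "independent (e ` {1..n})"
  proof (rule independent_if_scalars_zero)
    fix h v assume h: "(\<Sum>x\<in>e ` {1..n}. h x *\<^sub>R x) = 0" and "v \<in> e ` {1..n}"
    then obtain j where j: "j \<in> {1..n}" "v = e j"
      by blast
    have "(\<Sum>i = 1..n. h (e i) *\<^sub>R e i) = 0"
      using h by (simp add: sum.reindex[OF inj] del: One_nat_def)
    then have "h (e j) * r j = 0"
      using lookup_sum_e[of "\<lambda>i. h (e i)" j] j by simp
    then show "h v = 0"
      using assms(4) j by simp
  qed simp
  have "e i \<noteq> 0" if "i \<in> {1..n}" for i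
    using assms(4)[OF that] by (metis e_def lookup_single_eq lookup_zero)
  then have p_notin: "p \<notin> (\<lambda>i. p + e i) ` {1..n}"
    by auto
  \<comment> \<open>Translation by \<open>- p\<close> reduces affine hull and affine independence of
    \<open>B\<close> to span and linear independence of the rescaled unit vectors
    \<open>e i\<close>.\<close>
  have shift: "(\<lambda>x. - p + x) ` (\<lambda>i. p + e i) ` {1..n} = e ` {1..n}"
    by (simp add: image_image)
  have hull_B: "affine hull B = coord_space n"
  proof -
    have "p \<in> coord_space n"
      using assms(2,3) by blast
    \<comment> \<open>The affine hull of \<open>B\<close> is the span translated by
      \<open>p\<close>; as \<open>p\<close> lies in the subspace, the translation changes
      nothing.\<close>
    have "(\<lambda>x. p + x) ` coord_space n = coord_space n"
    proof
      show "(\<lambda>x. p + x) ` coord_space n \<subseteq> coord_space n"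
        using \<open>p \<in> coord_space n\<close> subspace_add[OF subspace_coord_space] by blast
      show "coord_space n \<subseteq> (\<lambda>x. p + x) ` coord_space n"
      proof
        fix x assume "x \<in> coord_space n"
        then have "x - p \<in> coord_space n"
          using \<open>p \<in> coord_space n\<close> by (rule subspace_diff[OF subspace_coord_space])
        then show "x \<in> (\<lambda>x. p + x) ` coord_space n"
          by (intro image_eqI[of _ _ "x - p"]) simp_all
      qed
    qed
    then show ?thesis
      by (simp only: B_def affine_hull_insert_span_gen shift span_e)
  qed
  have "affine hull S = coord_space n"
  proof
    show "affine hull S \<subseteq> coord_space n"
      using assms(2) subspace_coord_space by (intro hull_minimal subspace_imp_affine)
    have "B \<subseteq> S"
      using assms(3,5) by (auto simp: B_def e_def)
    then show "coord_space n \<subseteq> affine hull S"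
      using hull_mono hull_B by blast
  qed
  moreover have "\<not> affine_dependent B"
    using indep by (simp only: B_def affine_dependent_iff_dependent[OF p_notin] shift) simp
  moreover have "card B = n + 1"
  proof -
    have "inj_on (\<lambda>i. p + e i) {1..n}"
      using inj by (simp only: inj_on_def add_left_cancel)
    then show ?thesis
      using p_notin by (simp add: B_def card_image)
  qed
  ultimately show ?thesis
    using assms(1) hull_B unfolding polytope_of_dim_def by (intro conjI exI[of _ B]) simp_all
qed

section \<open>A uniform description of \<open>Q_polytope\<close> and its dimension\<close>

text \<open>This removes the case distinction. Longness of \<open>{m - 1, m}\<close> bounds the sum
  of the remaining lengths by \<open>\<alpha> m + \<alpha> (m - 1)\<close>, and no coordinate sum on
  the box exceeds that sum of lengths.\<close>

lemma Q_polytope_eq: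
  assumes "m \<ge> 2"
  shows "Q_polytope m \<alpha> = coord_box (m - 2) \<alpha>
    \<inter> {x. coord_sum (m - 2) x \<ge> \<alpha> m - \<alpha> (m - 1)} \<inter> {x. coord_sum (m - 2) x \<le> \<alpha> m + \<alpha> (m - 1)}"
proof (cases "long m \<alpha> {m - 1, m}")
  case True
  have eq: "{1..m} - {m - 1, m} = {1..m - 2}" "m - 1 \<noteq> m"
    using assms by auto
  have "(\<Sum>i = 1..m - 2. \<alpha> i) \<le> \<alpha> m + \<alpha> (m - 1)"
    using True eq by (auto simp: long_def short_def add.commute not_less)
  moreover have "coord_sum (m - 2) x \<le> (\<Sum>i = 1..m - 2. \<alpha> i)" if "x \<in> coord_box (m - 2) \<alpha>" for x
    using that unfolding coord_sum_def by (intro sum_mono) (auto simp: coord_box_def)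
  ultimately show ?thesis
    using True by (force simp: Q_polytope_def)
qed (simp add: Q_polytope_def)

lemma polytope_of_dim_Q_polytope:
  assumes "m \<ge> 2" and "length_vector m \<alpha>" and "\<alpha> m < (\<Sum>i = 1..m - 1. \<alpha> i)"
  shows "polytope_of_dim (m - 2) (Q_polytope m \<alpha>)"
proof -
  define n where "n = m - 2"
  have m: "m - 2 = n" "m - 1 = Suc n" "m = Suc (Suc n)"
    using assms(1) by (auto simp: n_def)
  define S where "S = (\<Sum>i = 1..n. \<alpha> i)"
  define lo where "lo = \<alpha> m - \<alpha> (m - 1)"
  define hi where "hi = \<alpha> m + \<alpha> (m - 1)"
  have pos: "\<And>i. i \<in> {1..n} \<Longrightarrow> 0 < \<alpha> i" "0 < \<alpha> m" "0 < \<alpha> (m - 1)"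
    using assms(1,2) by (auto simp: length_vector_def n_def)
  have "0 \<le> S"
    using pos(1) unfolding S_def by (intro sum_nonneg) (auto simp: less_imp_le)
  have bnds: "lo < S" "0 < hi" "lo < hi"
    using assms(3) pos by (simp_all add: lo_def hi_def S_def m)
  \<comment> \<open>The bounds in \<open>bnds\<close> make the open intervals from \<open>lo\<close>
    to \<open>hi\<close> and from \<open>- S\<close> to \<open>S\<close> overlap when
    \<open>S > 0\<close>; dividing a common point by \<open>S\<close> gives \<open>t\<close>. The
    case \<open>S = 0\<close> is that of the empty sum, \<open>m = 2\<close>.\<close>
  obtain t where t: "-1 < t" "t < 1" "lo < t * S" "t * S < hi"
  proof (cases "S = 0")
    case True
    then show ?thesis
      using bnds that[of 0] by simp
  next
    case False
    with \<open>0 \<le> S\<close> have "0 < S" by simp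
    then have "max lo (- S) < min hi S"
      using bnds by auto
    then obtain y where "max lo (- S) < y" "y < min hi S"
      using dense by blast
    then show ?thesis
      using \<open>0 < S\<close> that[of "y / S"] by (auto simp: field_simps)
  qed
  define p where "p = (\<Sum>i = 1..n. Poly_Mapping.single i (t * \<alpha> i))"
  have p: "Poly_Mapping.lookup p j = (if j \<in> {1..n} then t * \<alpha> j else 0)" for j
    by (simp add: p_def lookup_sum lookup_single when_def cong: if_cong)
  \<comment> \<open>The smaller of two slacks at \<open>p\<close>: that of coordinate
    \<open>i\<close> below \<open>\<alpha> i\<close>, and that of the coordinate sum below
    \<open>hi\<close>. Both are positive, and an upward move keeps all lower bounds.\<close>
  define r where "r i = min ((1 - t) * \<alpha> i) (hi - t * S)" for i
  have r: "0 < r i" "t * \<alpha> i + r i \<le> \<alpha> i" "t * S + r i \<le> hi" if "i \<in> {1..n}" for i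
    using that t pos(1)[of i] by (auto simp: r_def min_def algebra_simps)
  have t\<alpha>: "- \<alpha> i \<le> t * \<alpha> i" "t * \<alpha> i \<le> \<alpha> i" if "i \<in> {1..n}" for i
    using mult_right_mono[of "-1" t "\<alpha> i"] mult_right_mono[of t 1 "\<alpha> i"] t pos(1)[OF that] by auto
  have sum_p: "coord_sum n p = t * S"
    by (simp add: coord_sum_def p S_def sum_distrib_left)
  have Q: "Q_polytope m \<alpha> = coord_box n \<alpha> \<inter> {x. coord_sum n x \<ge> lo} \<inter> {x. coord_sum n x \<le> hi}"
    using Q_polytope_eq[OF assms(1)] by (simp add: n_def lo_def hi_def)
  have "polytope_of_dim n (Q_polytope m \<alpha>)"
  proof (rule polytope_of_dim_coord_space)
    show "polytope (Q_polytope m \<alpha>)"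
      unfolding Q by (intro polytope_Int_halfspace_le polytope_Int_halfspace_ge
          polytope_coord_box linear_coord_sum)
    show "Q_polytope m \<alpha> \<subseteq> coord_space n"
      by (auto simp: Q coord_box_def)
    show "p \<in> Q_polytope m \<alpha>"
      using t t\<alpha> by (auto simp: Q coord_box_def mem_coord_space_iff p sum_p)
    fix i assume i: "i \<in> {1..n}"
    show "r i \<noteq> 0"
      using r[OF i] by simp
    have "p + Poly_Mapping.single i (r i) \<in> coord_box n \<alpha>"
      using i t\<alpha> r[OF i] by (fastforce simp: coord_box_def mem_coord_space_iff p lookup_add
          lookup_single when_def)
    moreover have "coord_sum n (p + Poly_Mapping.single i (r i)) = t * S + r i"
      using i by (simp add: linear_add[OF linear_coord_sum] coord_sum_single sum_p)
    ultimately show "p + Poly_Mapping.single i (r i) \<in> Q_polytope m \<alpha>"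
      using t r[OF i] by (auto simp: Q)
  qed
  then show ?thesis
    by (simp add: n_def)
qed

section \<open>Forgetting the last coordinate\<close>

lemma affinely_isomorphic_moment_polytope_Q_polytope:
  assumes "m \<ge> 2"
  shows "affinely_isomorphic (m - 1) (moment_polytope m \<alpha>) (m - 2) (Q_polytope m \<alpha>)"
proof -
  define n where "n = m - 2"
  have m: "m - 2 = n" "m - 1 = Suc n" "m = Suc (Suc n)"
    using assms by (auto simp: n_def)
  \<comment> \<open>The smaller coordinate space is a subspace of the larger one, so forgetting a
    coordinate means setting it to zero. The map \<open>g\<close> restores it by solving the sum
    equation.\<close>
  define f where "f = (\<lambda>w. w - Poly_Mapping.single (Suc n) (Poly_Mapping.lookup w (Suc n) :: real))"
  define g where "g = (\<lambda>x. x + Poly_Mapping.single (Suc n) (\<alpha> m - coord_sum n x))"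
  have lookup_f: "Poly_Mapping.lookup (f w) i = (if i = Suc n then 0 else Poly_Mapping.lookup w i)" for w i
    by (simp add: f_def lookup_minus lookup_single when_def)
  have lookup_g: "Poly_Mapping.lookup (g x) i
      = (if i = Suc n then Poly_Mapping.lookup x i + (\<alpha> m - coord_sum n x) else Poly_Mapping.lookup x i)" for x i
    by (simp add: g_def lookup_add lookup_single when_def)
  have sum_f: "coord_sum n (f w) = coord_sum n w" for w
    by (simp add: coord_sum_def lookup_f)
  have sum_g: "coord_sum n (g x) = coord_sum n x" for x
    by (simp add: coord_sum_def lookup_g)
  have sum_Suc: "coord_sum (Suc n) w = coord_sum n w + Poly_Mapping.lookup w (Suc n)" for w
    by (simp add: coord_sum_def)
  have Q: "Q_polytope m \<alpha> = coord_box n \<alpha> \<inter> {x. coord_sum n x \<ge> \<alpha> m - \<alpha> (Suc n)}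
      \<inter> {x. coord_sum n x \<le> \<alpha> m + \<alpha> (Suc n)}"
    using Q_polytope_eq[OF assms, of \<alpha>] by (simp only: m(1,2))
  have P: "moment_polytope m \<alpha> = coord_box (Suc n) \<alpha> \<inter> {w. coord_sum (Suc n) w = \<alpha> m}"
    by (simp only: moment_polytope_def m(2))
  have "f ` coord_space (Suc n) \<subseteq> coord_space n"
    by (auto simp: mem_coord_space_iff lookup_f le_Suc_eq)
  then have "affine_map_on (coord_space (Suc n)) (coord_space n) f"
    by (auto simp: affine_map_on_def intro!: poly_mapping_eqI simp: lookup_f lookup_add)
  moreover have "bij_betw f (moment_polytope m \<alpha>) (Q_polytope m \<alpha>)"
  proof (rule bij_betw_byWitness[where f' = g])
    show "\<forall>w\<in>moment_polytope m \<alpha>. g (f w) = w"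
      by (auto simp: P sum_Suc lookup_g lookup_f sum_f intro!: poly_mapping_eqI)
    \<comment> \<open>Here coordinate \<open>Suc n\<close> of \<open>x\<close> is zero because
      \<open>x\<close> lies in the box of dimension \<open>n\<close>.\<close>
    show "\<forall>x\<in>Q_polytope m \<alpha>. f (g x) = x"
      by (auto simp: Q coord_box_def mem_coord_space_iff lookup_g lookup_f intro!: poly_mapping_eqI)
    show "f ` moment_polytope m \<alpha> \<subseteq> Q_polytope m \<alpha>"
    proof clarify
      fix w assume w: "w \<in> moment_polytope m \<alpha>"
      then have "Poly_Mapping.lookup w (Suc n) \<in> {- \<alpha> (Suc n)..\<alpha> (Suc n)}"
        by (auto simp: P coord_box_def)
      with w show "f w \<in> Q_polytope m \<alpha>"
        by (auto simp: P Q coord_box_def mem_coord_space_iff lookup_f sum_f sum_Suc le_Suc_eq)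
    qed
    show "g ` Q_polytope m \<alpha> \<subseteq> moment_polytope m \<alpha>"
      by (auto simp: P Q coord_box_def mem_coord_space_iff lookup_g sum_g sum_Suc le_Suc_eq)
  qed
  ultimately show ?thesis
    unfolding affinely_isomorphic_def m(1,2) by blast
qed

theorem theorem4p12:
  fixes m :: nat and \<alpha> :: "nat \<Rightarrow> real"
  assumes "m \<ge> 2"
    and "length_vector m \<alpha>"
    and "generic m \<alpha>"
    and "\<alpha> m < (\<Sum>i = 1..m - 1. \<alpha> i)"
  shows "polytope_of_dim (m - 2) (Q_polytope m \<alpha>) \<and>
         affinely_isomorphic (m - 1) (moment_polytope m \<alpha>) (m - 2) (Q_polytope m \<alpha>)"
  using polytope_of_dim_Q_polytope[OF assms(1,2,4)]
    affinely_isomorphic_moment_polytope_Q_polytope[OF assms(1)] by blast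

end
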